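(* Pseudo-time iterations with explicit Runge–Kutta methods are globally conservative if the initial guess has correct mass: let $\hat{\mathbf f}:\mathbb R^m\to\mathbb R^m$ be a globally conservative discretization with cell volumes $|\Omega_1|,\dots,|\Omega_m|$, let $\alpha\in\mathbb R$, $\mathbf u^n\in\mathbb R^m$, and let the iterates $\mathbf u^{(k)}$, $k=0,1,\dots$, be obtained by applying an explicit Runge–Kutta method with steps $\Delta\tau_k$ to $$\frac{\partial\mathbf u}{\partial\tau}+\mathbf u-\alpha\hat{\mathbf f}(\mathbf u)=\mathbf u^n,\qquad \mathbf u(0)=\mathbf u^{(0)}.$$ If $\sum_{i=1}^m|\Omega_i|u_i^{(0)}=\sum_{i=1}^m|\Omega_i|u_i^n$, then $\sum_{i=1}^m|\Omega_i|u_i^{(k+1)}=\sum_{i=1}^m|\Omega_i|u_i^n$ for all $k=0,1,\dots$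
   Context: $\hat{\mathbf f}=(\hat f_1,\dots,\hat f_m)^\top$ comes from a semidiscretization $\mathbf u_t=\hat{\mathbf f}(\mathbf u)$ on a mesh with cells $\Omega_i$ of volume $|\Omega_i|>0$; it is globally conservative if $\sum_{i=1}^m|\Omega_i|\hat f_i(\mathbf u)=0$ for all $\mathbf u\in\mathbb R^m$. The nonlinear system to be solved is $\mathbf u-\alpha\hat{\mathbf f}(\mathbf u)=\mathbf u^n$. Writing $\mathbf g(\mathbf w)=\mathbf w-\alpha\hat{\mathbf f}(\mathbf w)-\mathbf u^n$, one explicit $s$-stage Runge–Kutta step with coefficients $a_{j,l}$ ($l<j$) and $b_j$ is $$\mathbf U_j^{(k)}=\mathbf u^{(k)}-\Delta\tau_k\sum_{l=1}^{j-1}a_{j,l}\,\mathbf g(\mathbf U_l^{(k)}),\ j=1,\dots,s,\qquad \mathbf u^{(k+1)}=\mathbf u^{(k)}-\Delta\tau_k\sum_{j=1}^s b_j\,\mathbf g(\mathbf U_j^{(k)}).$$ *)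

theory Defs
  imports "HOL-Analysis.Analysis"
begin

definition total_mass :: "('m::finite \<Rightarrow> real) \<Rightarrow> real ^ 'm \<Rightarrow> real" where
  "total_mass vol u = (\<Sum>i\<in>UNIV. vol i * u $ i)"

definition globally_conservative ::
    "('m::finite \<Rightarrow> real) \<Rightarrow> (real ^ 'm \<Rightarrow> real ^ 'm) \<Rightarrow> bool" where
  "globally_conservative vol f \<longleftrightarrow> (\<forall>u. (\<Sum>i\<in>UNIV. vol i * f u $ i) = 0)"

definition residual ::
    "real \<Rightarrow> (real ^ 'm \<Rightarrow> real ^ 'm) \<Rightarrow> real ^ 'm \<Rightarrow> real ^ 'm \<Rightarrow> real ^ ('m::finite)" where
  "residual \<alpha> f un w = w - \<alpha> *\<^sub>R f w - un"

(* One step from v to w for the autonomous system du/dtau = - g u (hence the minus signs).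
   Stages are numbered 1..s; the stage sums run over l < j, so entries of a on or above the
   diagonal are never used and the stage vectors U 1, ..., U s are uniquely determined by v. *)
definition explicit_rk_step ::
    "nat \<Rightarrow> (nat \<Rightarrow> nat \<Rightarrow> real) \<Rightarrow> (nat \<Rightarrow> real) \<Rightarrow> (real ^ 'm \<Rightarrow> real ^ 'm) \<Rightarrow>
     real \<Rightarrow> real ^ 'm \<Rightarrow> real ^ ('m::finite) \<Rightarrow> bool" where
  "explicit_rk_step s a b g \<Delta>\<tau> v w \<longleftrightarrow>
     (\<exists>U :: nat \<Rightarrow> real ^ 'm.
        (\<forall>j\<in>{1..s}. U j = v - \<Delta>\<tau> *\<^sub>R (\<Sum>l\<in>{1..<j}. a j l *\<^sub>R g (U l))) \<and>
        w = v - \<Delta>\<tau> *\<^sub>R (\<Sum>j\<in>{1..s}. b j *\<^sub>R g (U j)))"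

end

theory Submission
  imports Defs
begin

text \<open>
  Total mass is a linear functional that annihilates the range of a globally conservative
  discretization. Applied to the residual \<open>w - \<alpha> f(w) - u\<^sup>n\<close> it therefore leaves only the mass
  defect of \<open>w\<close> relative to \<open>u\<^sup>n\<close>. So the hyperplane of states
  having the mass of \<open>u\<^sup>n\<close> is invariant: at each of its points the right-hand side of the
  pseudo-time equation has zero mass, that is, it is parallel to the hyperplane. An explicit
  Runge--Kutta method only adds linear combinations of right-hand sides at earlier stages, so its
  stages, and then the new iterate, cannot leave the hyperplane
  (\<open>explicit_rk_step_total_mass\<close>). The claim follows by induction on the iterates.
\<close>

lemma linear_total_mass: "linear (total_mass vol)"
  by (rule linearI)
    (simp_all add: total_mass_def sum.distrib sum_distrib_left algebra_simps)

lemma total_mass_residual: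
  assumes "globally_conservative vol f"
  shows "total_mass vol (residual \<alpha> f un w) = total_mass vol w - total_mass vol un"
proof -
  have "total_mass vol (f w) = 0"
    using assms by (simp add: globally_conservative_def total_mass_def)
  then show ?thesis
    by (simp add: residual_def linear_diff[OF linear_total_mass] linear_scale[OF linear_total_mass])
qed

lemma total_mass_rk_update:
  assumes "\<And>l. l \<in> A \<Longrightarrow> total_mass vol (x l) = 0"
  shows "total_mass vol (v - h *\<^sub>R (\<Sum>l\<in>A. c l *\<^sub>R x l)) = total_mass vol v"
  using assms
  by (simp add: linear_diff[OF linear_total_mass] linear_scale[OF linear_total_mass]
      linear_sum[OF linear_total_mass])

text \<open>
  Explicitness carries the argument: stage \<open>j\<close> uses the right-hand side only at stages \<open>l < j\<close>,
  so strong induction on the stage number shows that every stage lies on the hyperplane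
  of mass \<open>M\<close>, the only place where \<open>g\<close> is known to have zero mass.
\<close>

lemma explicit_rk_step_total_mass:
  assumes step: "explicit_rk_step s a b g h v w"
    and tangent: "\<And>x. total_mass vol x = M \<Longrightarrow> total_mass vol (g x) = 0"
    and start: "total_mass vol v = M"
  shows "total_mass vol w = M"
proof -
  obtain U where
    stages: "\<And>j. j \<in> {1..s} \<Longrightarrow> U j = v - h *\<^sub>R (\<Sum>l\<in>{1..<j}. a j l *\<^sub>R g (U l))"
    and w: "w = v - h *\<^sub>R (\<Sum>j\<in>{1..s}. b j *\<^sub>R g (U j))"
    using step unfolding explicit_rk_step_def by blast
  have stage_mass: "total_mass vol (U j) = M" if "j \<in> {1..s}" for j
    using that
  proof (induction j rule: less_induct)
    case (less j)
    have "total_mass vol (g (U l)) = 0" if "l \<in> {1..<j}" for l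
      using that less by (intro tangent) auto
    then show ?case
      using start by (subst stages[OF less.prems], subst total_mass_rk_update) auto
  qed
  show ?thesis
    unfolding w by (subst total_mass_rk_update) (simp_all add: start tangent stage_mass)
qed

theorem mainTheorem7:
  fixes vol :: "'m::finite \<Rightarrow> real"
    and f :: "real ^ 'm \<Rightarrow> real ^ 'm"
    and \<alpha> :: real
    and un :: "real ^ 'm"
    and s :: nat
    and a :: "nat \<Rightarrow> nat \<Rightarrow> real"
    and b :: "nat \<Rightarrow> real"
    and \<Delta>\<tau> :: "nat \<Rightarrow> real"
    and u :: "nat \<Rightarrow> real ^ 'm"
  assumes "\<And>i. vol i > 0"
    and "globally_conservative vol f"
    and "\<And>k. explicit_rk_step s a b (residual \<alpha> f un) (\<Delta>\<tau> k) (u k) (u (Suc k))"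
    and "total_mass vol (u 0) = total_mass vol un"
  shows "\<forall>k. total_mass vol (u (Suc k)) = total_mass vol un"
proof -
  have "total_mass vol (u k) = total_mass vol un" for k
  proof (induction k)
    case 0
    show ?case by (fact assms(4))
  next
    case (Suc k)
    show ?case
      using assms(3) _ Suc.IH
      by (rule explicit_rk_step_total_mass) (simp add: total_mass_residual[OF assms(2)])
  qed
  then show ?thesis by blast
qed

end
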